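(* Assume that $(f,f';h)$ satisfies the basic assumptions with parameters $M_f\ge0$ and $M_h\in[0,\infty)$, and put $M=M_f+M_h$. Let $x_0\in\operatorname{dom}h$, $\lambda>0$ and a tolerance pair $(\hat\rho,\hat\varepsilon)\in\mathbb{R}_{++}^2$ be given. Then the following statements hold for RPB$(x_0,\lambda,\delta)$ with $\delta=\hat\varepsilon/3$: (a) the number of serious iterations performed until it obtains a $(\hat\rho,\hat\varepsilon)$-solution triple $(\hat z_k,\hat v_k,\hat\varepsilon_k)$ is bounded by $$\mathcal{O}_1\left(\max\left\{\frac{\hat\varepsilon}{\lambda\hat\rho^2},\ \frac{d_0^2}{\lambda\hat\varepsilon}\right\}\right);$$ (b) the total number of iterations (serious and null) performed until it obtains a $(\hat\rho,\hat\varepsilon)$-solution triple $(\hat z_k,\hat v_k,\hat\varepsilon_k)$ is bounded by $$\mathcal{O}_1\left(\max\left\{\frac{MM_f}{\hat\rho^2},\ \frac{MM_fd_0^2}{\hat\varepsilon^2}\right\}+\max\left\{\frac{\hat\varepsilon}{\lambda\hat\rho^2},\ \frac{d_0^2}{\lambda\hat\varepsilon}\right\}+\frac{\lambda MM_f}{\hat\varepsilon}\right).$$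
   Context: Problem: $\phi^*:=\min\{\phi(x):=f(x)+h(x):x\in\mathbb{R}^n\}$. We say $(f,f';h)$ satisfies the basic assumptions with parameters $(M_f,M_h)$ if: (i) $f,h:\mathbb{R}^n\to(-\infty,+\infty]$ are proper lower semicontinuous convex, $\operatorname{dom}h\subset\operatorname{dom}f$, and $f':\operatorname{dom}h\to\mathbb{R}^n$ satisfies $f'(x)\in\partial f(x)$ for all $x\in\operatorname{dom}h$; (ii) the set $X^*$ of minimizers of $\phi$ is nonempty; (iii) $\|f'(x)\|\le M_f$ for all $x\in\operatorname{dom}h$; (iv) $|h(u)-h(v)|\le M_h\|u-v\|$ for all $u,v\in\operatorname{dom}h$. Here $\|\cdot\|$ is the Euclidean norm. $d_0:=\inf\{\|x_0-x^*\|:x^*\in X^*\}$. Method RPB$(x_0,\lambda,\delta)$ ($x_0\in\operatorname{dom}h$, $\lambda>0$, $\delta>0$). Set $x_0^c=\tilde x_0=\hat z_0=x_0$, $C_1=\{x_0\}$, $k=1$. For $j=1,2,\dots$: let $f_j(u)=\max\{f(x)+\langle f'(x),u-x\rangle:x\in C_j\}$; let $x_j$ be the unique minimizer and $m_j$ the minimum value over $u\in\mathbb{R}^n$ of $f_j(u)+h(u)+\frac1{2\lambda}\|u-x_{j-1}^c\|^2$; let $\phi_j^\lambda:=\phi+\frac1{2\lambda}\|\cdot-x_{j-1}^c\|^2$; choose $\tilde x_j\in\operatorname{Argmin}\{\phi_j^\lambda(u):u\in\{x_j,\tilde x_{j-1}\}\}$; let $t_j:=\phi_j^\lambda(\tilde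 x_j)-m_j$. If $t_j\le\delta$ (iteration $j$ is serious): choose any finite $C_{j+1}$ with $\{x_j\}\subset C_{j+1}\subset\{x_0,\dots,x_j\}$, set $x_j^c=x_j$, choose $\hat z_k\in\operatorname{Argmin}\{\phi(u):u\in\{\hat z_{k-1},\tilde x_j\}\}$, and increase $k$ by 1. Otherwise (iteration $j$ is null): set $x_j^c=x_{j-1}^c$ and choose any $C_{j+1}$ with $A_j\cup\{x_j\}\subset C_{j+1}\subset C_j\cup\{x_j\}$, where $A_j:=\{x\in C_j:f(x)+\langle f'(x),x_j-x\rangle=f_j(x_j)\}$. The statement holds for all admissible choices. Let $0=j_0<j_1<j_2<\cdots$ be the serious iteration indices ($j=0$ is serious by convention), $z_0=\tilde z_0=x_0$, and for $k\ge1$: $z_k:=x_{j_k}$, $\tilde z_k:=\tilde x_{j_k}$, $\tilde f_k:=f_{j_k}$, $\delta_k:=\phi(\tilde z_k)-(\tilde f_k+h)(z_k)-\frac{1}{2\lambda}\|z_k-z_{k-1}\|^2$, and $$\hat v_k:=\frac{z_0-z_k}{\lambda k},\qquad\hat\varepsilon_k:=\frac1k\sum_{i=1}^k\delta_i+\frac{\|\hat z_k-z_0\|^2-\|\hat z_k-z_k\|^2}{2\lambda k}.$$ A triple $(x,v,\eta)$ is a $(\hat\rho,\hat\varepsilon)$-solution triple if $v\in\partial_\eta\phi(x)$, $\|v\|\le\hat\rho$ and $\eta\le\hat\varepsilon$, where $\partial_\eta\phi(x)=\{s:\phi(u)\ge\phi(x)+\langle s,u-x\rangle-\eta\ \forall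 u\in\mathbb{R}^n\}$. $p=\mathcal{O}_1(q)$ means $p\le\bar c\,(q+1)$ for an absolute constant $\bar c$. *)

theory Defs
  imports
    "Jordan_Normal_Form.Matrix"
    "HOL-Library.Extended_Real"
    "HOL-Library.Infinite_Set"
begin

text \<open>
  The space R^n is the carrier \<open>carrier_vec n\<close> of the type \<open>real vec\<close>, so that constants can be
  required not to depend on the dimension. Functions on R^n with values in the extended reals are
  total on the type \<open>real vec\<close>, but only their values on \<open>carrier_vec n\<close> are ever used.
\<close>

definition vnorm :: "real vec \<Rightarrow> real" where
  "vnorm v = sqrt (scalar_prod v v)"

definition edom :: "nat \<Rightarrow> (real vec \<Rightarrow> ereal) \<Rightarrow> real vec set" where
  "edom n g = {x \<in> carrier_vec n. g x < \<infinity>}"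

definition proper_fun :: "nat \<Rightarrow> (real vec \<Rightarrow> ereal) \<Rightarrow> bool" where
  "proper_fun n g \<longleftrightarrow> (\<forall>x \<in> carrier_vec n. g x \<noteq> - \<infinity>) \<and> edom n g \<noteq> {}"

definition lsc_fun :: "nat \<Rightarrow> (real vec \<Rightarrow> ereal) \<Rightarrow> bool" where
  "lsc_fun n g \<longleftrightarrow>
     (\<forall>x \<in> carrier_vec n. \<forall>a. a < g x \<longrightarrow>
        (\<exists>r>0. \<forall>y \<in> carrier_vec n. vnorm (y - x) < r \<longrightarrow> a < g y))"

definition convex_fun :: "nat \<Rightarrow> (real vec \<Rightarrow> ereal) \<Rightarrow> bool" where
  "convex_fun n g \<longleftrightarrow>
     (\<forall>x \<in> carrier_vec n. \<forall>y \<in> carrier_vec n. \<forall>t::real. 0 < t \<and> t < 1 \<longrightarrow>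
        g ((1 - t) \<cdot>\<^sub>v x + t \<cdot>\<^sub>v y) \<le> ereal (1 - t) * g x + ereal t * g y)"

definition argmin_set :: "real vec set \<Rightarrow> (real vec \<Rightarrow> ereal) \<Rightarrow> real vec set" where
  "argmin_set S g = {x \<in> S. \<forall>u \<in> S. g x \<le> g u}"

definition eps_subdiff :: "nat \<Rightarrow> (real vec \<Rightarrow> ereal) \<Rightarrow> real \<Rightarrow> real vec \<Rightarrow> real vec set" where
  "eps_subdiff n g \<eta> x =
     {s \<in> carrier_vec n. \<forall>u \<in> carrier_vec n.
        g u \<ge> g x + ereal (scalar_prod s (u - x)) - ereal \<eta>}"

definition subdiff :: "nat \<Rightarrow> (real vec \<Rightarrow> ereal) \<Rightarrow> real vec \<Rightarrow> real vec set" where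
  "subdiff n g x =
     {s \<in> carrier_vec n. \<forall>u \<in> carrier_vec n. g u \<ge> g x + ereal (scalar_prod s (u - x))}"

definition objective :: "(real vec \<Rightarrow> ereal) \<Rightarrow> (real vec \<Rightarrow> ereal) \<Rightarrow> real vec \<Rightarrow> ereal" where
  "objective f h x = f x + h x"

definition basic_assumptions ::
  "nat \<Rightarrow> (real vec \<Rightarrow> ereal) \<Rightarrow> (real vec \<Rightarrow> real vec) \<Rightarrow> (real vec \<Rightarrow> ereal) \<Rightarrow> real \<Rightarrow> real \<Rightarrow> bool"
where
  "basic_assumptions n f f' h M\<^sub>f M\<^sub>h \<longleftrightarrow>
     proper_fun n f \<and> lsc_fun n f \<and> convex_fun n f \<and>
     proper_fun n h \<and> lsc_fun n h \<and> convex_fun n h \<and>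
     edom n h \<subseteq> edom n f \<and>
     (\<forall>x \<in> edom n h. f' x \<in> subdiff n f x) \<and>
     argmin_set (carrier_vec n) (objective f h) \<noteq> {} \<and>
     (\<forall>x \<in> edom n h. vnorm (f' x) \<le> M\<^sub>f) \<and>
     (\<forall>u \<in> edom n h. \<forall>v \<in> edom n h. \<bar>h u - h v\<bar> \<le> ereal (M\<^sub>h * vnorm (u - v)))"

definition dist_opt ::
  "nat \<Rightarrow> (real vec \<Rightarrow> ereal) \<Rightarrow> (real vec \<Rightarrow> ereal) \<Rightarrow> real vec \<Rightarrow> real" where
  "dist_opt n f h x\<^sub>0 = (INF x \<in> argmin_set (carrier_vec n) (objective f h). vnorm (x\<^sub>0 - x))"

definition solution_triple ::
  "nat \<Rightarrow> (real vec \<Rightarrow> ereal) \<Rightarrow> real \<Rightarrow> real \<Rightarrow> real vec \<times> real vec \<times> real \<Rightarrow> bool" where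
  "solution_triple n \<phi> \<rho> \<epsilon> = (\<lambda>(x, v, \<eta>).
     x \<in> carrier_vec n \<and> v \<in> eps_subdiff n \<phi> \<eta> x \<and> vnorm v \<le> \<rho> \<and> \<eta> \<le> \<epsilon>)"

definition linearization ::
  "(real vec \<Rightarrow> ereal) \<Rightarrow> (real vec \<Rightarrow> real vec) \<Rightarrow> real vec \<Rightarrow> real vec \<Rightarrow> ereal" where
  "linearization f f' x u = f x + ereal (scalar_prod (f' x) (u - x))"

definition cut_model ::
  "(real vec \<Rightarrow> ereal) \<Rightarrow> (real vec \<Rightarrow> real vec) \<Rightarrow> real vec set \<Rightarrow> real vec \<Rightarrow> ereal" where
  "cut_model f f' C u = Max ((\<lambda>x. linearization f f' x u) ` C)"

definition add_prox :: "real \<Rightarrow> real vec \<Rightarrow> (real vec \<Rightarrow> ereal) \<Rightarrow> real vec \<Rightarrow> ereal" where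
  "add_prox lam c g u = g u + ereal ((vnorm (u - c))\<^sup>2 / (2 * lam))"

text \<open>
  The sequences generated by an execution of the method. \<open>cuts j\<close> is $C_j$ (for $j \ge 1$),
  \<open>iter j\<close> is $x_j$, \<open>center j\<close> is $x_j^c$, \<open>best j\<close> is $\tilde x_j$, \<open>zhat k\<close> is $\hat z_k$, and
  \<open>counter j\<close> is the value of the variable $k$ after iteration $j$.
\<close>

record rpb_trace =
  cuts :: "nat \<Rightarrow> real vec set"
  iter :: "nat \<Rightarrow> real vec"
  center :: "nat \<Rightarrow> real vec"
  best :: "nat \<Rightarrow> real vec"
  counter :: "nat \<Rightarrow> nat"
  zhat :: "nat \<Rightarrow> real vec"

definition model_fun ::
  "(real vec \<Rightarrow> ereal) \<Rightarrow> (real vec \<Rightarrow> real vec) \<Rightarrow> rpb_trace \<Rightarrow> nat \<Rightarrow> real vec \<Rightarrow> ereal" where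
  "model_fun f f' R j = cut_model f f' (cuts R j)"

definition model_prox ::
  "(real vec \<Rightarrow> ereal) \<Rightarrow> (real vec \<Rightarrow> real vec) \<Rightarrow> (real vec \<Rightarrow> ereal) \<Rightarrow> real \<Rightarrow> rpb_trace \<Rightarrow>
   nat \<Rightarrow> real vec \<Rightarrow> ereal" where
  "model_prox f f' h lam R j =
     add_prox lam (center R (j - 1)) (\<lambda>u. model_fun f f' R j u + h u)"

definition objective_prox ::
  "(real vec \<Rightarrow> ereal) \<Rightarrow> (real vec \<Rightarrow> ereal) \<Rightarrow> real \<Rightarrow> rpb_trace \<Rightarrow> nat \<Rightarrow> real vec \<Rightarrow> ereal" where
  "objective_prox f h lam R j = add_prox lam (center R (j - 1)) (objective f h)"

text \<open>
  The number $t_j$; the minimum value $m_j$ is the value of the prox subproblem at its minimizer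
  \<open>iter R j\<close>.
\<close>

definition gap ::
  "(real vec \<Rightarrow> ereal) \<Rightarrow> (real vec \<Rightarrow> real vec) \<Rightarrow> (real vec \<Rightarrow> ereal) \<Rightarrow> real \<Rightarrow> rpb_trace \<Rightarrow>
   nat \<Rightarrow> ereal" where
  "gap f f' h lam R j =
     objective_prox f h lam R j (best R j) - model_prox f f' h lam R j (iter R j)"

definition active_cuts ::
  "(real vec \<Rightarrow> ereal) \<Rightarrow> (real vec \<Rightarrow> real vec) \<Rightarrow> rpb_trace \<Rightarrow> nat \<Rightarrow> real vec set" where
  "active_cuts f f' R j =
     {x \<in> cuts R j. linearization f f' x (iter R j) = model_fun f f' R j (iter R j)}"

definition serious_step ::
  "(real vec \<Rightarrow> ereal) \<Rightarrow> (real vec \<Rightarrow> ereal) \<Rightarrow> rpb_trace \<Rightarrow> nat \<Rightarrow> bool" where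
  "serious_step f h R j \<longleftrightarrow>
     finite (cuts R (Suc j)) \<and> {iter R j} \<subseteq> cuts R (Suc j) \<and>
     cuts R (Suc j) \<subseteq> iter R ` {0..j} \<and>
     center R j = iter R j \<and>
     (let k = counter R (j - 1) in
        zhat R k \<in> argmin_set {zhat R (k - 1), best R j} (objective f h) \<and>
        counter R j = k + 1)"

definition null_step ::
  "(real vec \<Rightarrow> ereal) \<Rightarrow> (real vec \<Rightarrow> real vec) \<Rightarrow> rpb_trace \<Rightarrow> nat \<Rightarrow> bool" where
  "null_step f f' R j \<longleftrightarrow>
     active_cuts f f' R j \<union> {iter R j} \<subseteq> cuts R (Suc j) \<and>
     cuts R (Suc j) \<subseteq> cuts R j \<union> {iter R j} \<and>
     center R j = center R (j - 1) \<and>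
     counter R j = counter R (j - 1)"

text \<open>
  \<open>R\<close> is an execution of RPB with admissible choices. The minimizer of the prox subproblem is
  unique by strong convexity, so membership in the set of minimizers determines \<open>iter R j\<close>.
\<close>

definition rpb_run ::
  "nat \<Rightarrow> (real vec \<Rightarrow> ereal) \<Rightarrow> (real vec \<Rightarrow> real vec) \<Rightarrow> (real vec \<Rightarrow> ereal) \<Rightarrow>
   real vec \<Rightarrow> real \<Rightarrow> real \<Rightarrow> rpb_trace \<Rightarrow> bool" where
  "rpb_run n f f' h x\<^sub>0 lam \<delta> R \<longleftrightarrow>
     iter R 0 = x\<^sub>0 \<and> center R 0 = x\<^sub>0 \<and> best R 0 = x\<^sub>0 \<and> zhat R 0 = x\<^sub>0 \<and>
     cuts R 1 = {x\<^sub>0} \<and> counter R 0 = 1 \<and>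
     (\<forall>j\<ge>1.
        iter R j \<in> argmin_set (carrier_vec n) (model_prox f f' h lam R j) \<and>
        best R j \<in> argmin_set {iter R j, best R (j - 1)} (objective_prox f h lam R j) \<and>
        (if gap f f' h lam R j \<le> ereal \<delta> then serious_step f h R j else null_step f f' R j))"

definition serious_indices ::
  "(real vec \<Rightarrow> ereal) \<Rightarrow> (real vec \<Rightarrow> real vec) \<Rightarrow> (real vec \<Rightarrow> ereal) \<Rightarrow> real \<Rightarrow> real \<Rightarrow>
   rpb_trace \<Rightarrow> nat set" where
  "serious_indices f f' h lam \<delta> R = insert 0 {j. 1 \<le> j \<and> gap f f' h lam R j \<le> ereal \<delta>}"

text \<open>
  The index $j_k$ is \<open>enumerate S k\<close> for \<open>S\<close> the set of serious indices. It is meaningful only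
  when \<open>S\<close> has more than \<open>k\<close> elements, which is what \<open>serious_occurs\<close> expresses.
\<close>

definition serious_occurs :: "nat set \<Rightarrow> nat \<Rightarrow> bool" where
  "serious_occurs S k \<longleftrightarrow> infinite S \<or> k < card S"

text \<open>
  The number $\delta_k$, where \<open>J i\<close> stands for $j_i$. All extended-real values in it are finite
  along an execution.
\<close>

definition delta_k ::
  "(real vec \<Rightarrow> ereal) \<Rightarrow> (real vec \<Rightarrow> real vec) \<Rightarrow> (real vec \<Rightarrow> ereal) \<Rightarrow> real \<Rightarrow> rpb_trace \<Rightarrow>
   (nat \<Rightarrow> nat) \<Rightarrow> nat \<Rightarrow> real" where
  "delta_k f f' h lam R J k =
     real_of_ereal (objective f h (best R (J k)))
       - real_of_ereal (model_fun f f' R (J k) (iter R (J k)) + h (iter R (J k)))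
       - (vnorm (iter R (J k) - iter R (J (k - 1))))\<^sup>2 / (2 * lam)"

definition vhat :: "real \<Rightarrow> rpb_trace \<Rightarrow> (nat \<Rightarrow> nat) \<Rightarrow> nat \<Rightarrow> real vec" where
  "vhat lam R J k = (1 / (lam * real k)) \<cdot>\<^sub>v (iter R (J 0) - iter R (J k))"

definition epshat ::
  "(real vec \<Rightarrow> ereal) \<Rightarrow> (real vec \<Rightarrow> real vec) \<Rightarrow> (real vec \<Rightarrow> ereal) \<Rightarrow> real \<Rightarrow> rpb_trace \<Rightarrow>
   (nat \<Rightarrow> nat) \<Rightarrow> nat \<Rightarrow> real" where
  "epshat f f' h lam R J k =
     (1 / real k) * (\<Sum>i = 1..k. delta_k f f' h lam R J i)
       + ((vnorm (zhat R k - iter R (J 0)))\<^sup>2 - (vnorm (zhat R k - iter R (J k)))\<^sup>2)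
           / (2 * lam * real k)"

definition solves_at ::
  "nat \<Rightarrow> (real vec \<Rightarrow> ereal) \<Rightarrow> (real vec \<Rightarrow> real vec) \<Rightarrow> (real vec \<Rightarrow> ereal) \<Rightarrow> real \<Rightarrow>
   real \<Rightarrow> real \<Rightarrow> rpb_trace \<Rightarrow> (nat \<Rightarrow> nat) \<Rightarrow> nat \<Rightarrow> bool" where
  "solves_at n f f' h lam \<rho> \<epsilon> R J k \<longleftrightarrow>
     solution_triple n (objective f h) \<rho> \<epsilon> (zhat R k, vhat lam R J k, epshat f f' h lam R J k)"

end

theory Submission
  imports Defs "HOL-Analysis.L2_Norm"
begin

text \<open>
  The argument has two halves: every cycle between consecutive serious steps is short, and few
  serious steps suffice. Write \<open>M = M_f + M_h\<close>.

  Short cycles. Inside a cycle the prox center is fixed. A null step keeps the active cuts, and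
  these alone already make the old iterate the minimizer of a prox problem with quadratic growth
  (\<open>prox_growth_active\<close>). Hence the minimum value rises, and the gap \<open>t_j\<close> drops, by at least
  \<open>d\<^sup>2 / (2 lam)\<close>, where \<open>d\<close> is the length of the next move; on the other hand the next gap is at
  most \<open>2 M_f d\<close>, because the last iterate has become a cut (\<open>tau_le_step\<close>). Eliminating \<open>d\<close>
  yields a quadratic recursion for the gap, with first value at most \<open>T = 2 lam M M_f\<close>, and so the
  \<open>l\<close>-th gap of a cycle is at most \<open>8 T / l\<close> (\<open>cycle_gap_decay\<close>). It exceeds \<open>\<delta>\<close> only while
  \<open>l < 8 T / \<delta>\<close>, so a cycle has at most \<open>8 T / \<delta>\<close> null steps; in particular every cycle ends.

  Few serious steps. A serious step is a proximal step for the full objective with error at most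
  \<open>\<delta>\<close>. Averaging the corresponding inequalities telescopes the squared distances
  (\<open>averaged_prox_inequality\<close>) and shows that the averaged vector is an
  approximate subgradient, for every \<open>k\<close>, with the error attached to it in the triple
  (\<open>vhat_eps_subgradient\<close>). Tested at a solution, the same inequality keeps the \<open>k\<close>-th serious
  iterate within \<open>2 d_0 + sqrt (2 lam \<delta> k)\<close> of the starting point. Thus the norm of the averaged
  vector is of order \<open>d_0 / (lam k) + sqrt (\<delta> / (lam k))\<close>, and the distance term of the error stays
  below \<open>2 \<delta>\<close> once \<open>k\<close> is at least 36 and a fixed multiple of \<open>d_0\<^sup>2 / (lam \<delta>)\<close>
  (\<open>solution_triple_reached\<close>).

  The bound on the total number of iterations is the product of the two counts: the number of
  serious steps times \<open>lam M M_f / \<epsilon>\<close> gives the first and the last term.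
\<close>

section \<open>Euclidean geometry of coordinate vectors\<close>

lemma vnorm_eq_L2_set:
  assumes "v \<in> carrier_vec n"
  shows "vnorm v = L2_set (\<lambda>i. v $ i) {0..<n}"
  using assms by (simp add: vnorm_def scalar_prod_def L2_set_def power2_eq_square)

lemma vnorm_nonneg [simp]: "0 \<le> vnorm v"
  by (simp add: vnorm_def scalar_prod_def sum_nonneg)

lemma vnorm_power2_sum:
  assumes "v \<in> carrier_vec n"
  shows "(vnorm v)\<^sup>2 = (\<Sum>i = 0..<n. (v $ i)\<^sup>2)"
  unfolding vnorm_eq_L2_set[OF assms] L2_set_def by (simp add: sum_nonneg)

lemma scalar_prod_Cauchy_Schwarz:
  assumes "u \<in> carrier_vec n" "v \<in> carrier_vec n"
  shows "\<bar>scalar_prod u v\<bar> \<le> vnorm u * vnorm v"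
proof -
  have "\<bar>scalar_prod u v\<bar> \<le> (\<Sum>i = 0..<n. \<bar>u $ i\<bar> * \<bar>v $ i\<bar>)"
    using assms by (auto simp: scalar_prod_def abs_mult intro: order_trans[OF sum_abs])
  also have "\<dots> \<le> vnorm u * vnorm v"
    using L2_set_mult_ineq assms by (simp add: vnorm_eq_L2_set)
  finally show ?thesis .
qed

lemma vnorm_diff_triangle:
  assumes "u \<in> carrier_vec n" "v \<in> carrier_vec n" "w \<in> carrier_vec n"
  shows "vnorm (u - w) \<le> vnorm (u - v) + vnorm (v - w)"
proof -
  have "vnorm (u - w) = L2_set (\<lambda>i. (u - v) $ i + (v - w) $ i) {0..<n}"
    using assms by (subst vnorm_eq_L2_set[of _ n]) (auto intro!: L2_set_cong)
  also have "\<dots> \<le> vnorm (u - v) + vnorm (v - w)"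
    using assms L2_set_triangle_ineq by (simp add: vnorm_eq_L2_set[of _ n])
  finally show ?thesis .
qed

lemma vnorm_diff_commute:
  assumes "u \<in> carrier_vec n" "v \<in> carrier_vec n"
  shows "vnorm (u - v) = vnorm (v - u)"
proof -
  have "(vnorm (u - v))\<^sup>2 = (vnorm (v - u))\<^sup>2"
    using assms by (auto simp: vnorm_power2_sum[of _ n] intro!: sum.cong power2_commute)
  then show ?thesis by simp
qed

lemma vnorm_diff_self [simp]: "vnorm (v - v) = 0"
  by (simp add: vnorm_def scalar_prod_def)

lemma vnorm_smult:
  "vnorm (a \<cdot>\<^sub>v v) = \<bar>a\<bar> * vnorm v"
proof -
  have "scalar_prod (a \<cdot>\<^sub>v v) (a \<cdot>\<^sub>v v) = a\<^sup>2 * scalar_prod v v"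
    by (simp add: power2_eq_square)
  then show ?thesis by (simp add: vnorm_def real_sqrt_mult)
qed

lemma vnorm_power2_segment:
  assumes "x \<in> carrier_vec n" "u \<in> carrier_vec n" "c \<in> carrier_vec n"
  shows "(vnorm ((1 - s) \<cdot>\<^sub>v x + s \<cdot>\<^sub>v u - c))\<^sup>2 =
    (1 - s) * (vnorm (x - c))\<^sup>2 + s * (vnorm (u - c))\<^sup>2 - s * (1 - s) * (vnorm (u - x))\<^sup>2"
proof -
  have id: "((1 - s) * a + s * b - e)\<^sup>2 =
      (1 - s) * (a - e)\<^sup>2 + s * (b - e)\<^sup>2 - s * (1 - s) * (b - a)\<^sup>2" for a b e :: real
    by (simp add: power2_eq_square algebra_simps)
  have "(\<Sum>i = 0..<n. (((1 - s) \<cdot>\<^sub>v x + s \<cdot>\<^sub>v u - c) $ i)\<^sup>2) =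
      (\<Sum>i = 0..<n. (1 - s) * ((x - c) $ i)\<^sup>2 + s * ((u - c) $ i)\<^sup>2 - s * (1 - s) * ((u - x) $ i)\<^sup>2)"
    using assms by (intro sum.cong refl) (simp add: id)
  then show ?thesis
    using assms
    by (simp add: vnorm_power2_sum[of _ n] sum.distrib sum_subtractf sum_distrib_left)
qed

text \<open>
  The squared norm of \<open>u\<close> cancels in the difference of two squared distances, which is therefore
  affine in \<open>u\<close>. This is what turns the telescoped prox terms into the single vector \<^term>\<open>vhat\<close>.
\<close>

lemma vnorm_power2_diff_affine:
  assumes "u \<in> carrier_vec n" "y \<in> carrier_vec n" "z \<in> carrier_vec n" "w \<in> carrier_vec n"
  shows "(vnorm (u - z))\<^sup>2 - (vnorm (u - w))\<^sup>2 =
    (vnorm (y - z))\<^sup>2 - (vnorm (y - w))\<^sup>2 + 2 * scalar_prod (w - z) (u - y)"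
proof -
  have id: "(a - b)\<^sup>2 - (a - e)\<^sup>2 = (d - b)\<^sup>2 - (d - e)\<^sup>2 + 2 * ((e - b) * (a - d))"
    for a b d e :: real
    by (simp add: power2_eq_square algebra_simps)
  have "(\<Sum>i = 0..<n. ((u - z) $ i)\<^sup>2 - ((u - w) $ i)\<^sup>2) =
     (\<Sum>i = 0..<n. ((y - z) $ i)\<^sup>2 - ((y - w) $ i)\<^sup>2 + 2 * ((w - z) $ i * (u - y) $ i))"
    using assms by (intro sum.cong refl) (simp add: id)
  moreover have "scalar_prod (w - z) (u - y) = (\<Sum>i = 0..<n. (w - z) $ i * (u - y) $ i)"
    using assms by (auto simp: scalar_prod_def)
  ultimately show ?thesis
    using assms
    by (simp add: vnorm_power2_sum[of _ n] sum.distrib sum_subtractf sum_distrib_left del: index_minus_vec)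
qed

lemma scalar_prod_segment:
  fixes s :: real
  assumes "s' \<in> carrier_vec n" "x \<in> carrier_vec n" "u \<in> carrier_vec n" "y \<in> carrier_vec n"
  shows "scalar_prod s' ((1 - s) \<cdot>\<^sub>v x + s \<cdot>\<^sub>v u - y) =
    (1 - s) * scalar_prod s' (x - y) + s * scalar_prod s' (u - y)"
proof -
  have id: "q * ((1 - s) * a + s * b - e) = (1 - s) * (q * (a - e)) + s * (q * (b - e))"
    for q a b e :: real
    by (simp add: power2_eq_square algebra_simps)
  have "(\<Sum>i = 0..<n. s' $ i * ((1 - s) \<cdot>\<^sub>v x + s \<cdot>\<^sub>v u - y) $ i) =
     (\<Sum>i = 0..<n. (1 - s) * (s' $ i * (x - y) $ i) + s * (s' $ i * (u - y) $ i))"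
    using assms by (intro sum.cong refl) (simp add: id)
  then show ?thesis
    using assms by (auto simp: scalar_prod_def sum.distrib sum_distrib_left)
qed

section \<open>A quadratic recursion with harmonic decay\<close>

text \<open>
  The recursion is a discrete form of the differential inequality \<open>a' \<le> - a\<^sup>2 / (4 T)\<close>, whose
  solutions decay like \<open>T / l\<close>. The constant 8 leaves enough room for the discretisation: if
  \<open>a (l + 1)\<close> exceeded \<open>8 T / (l + 1)\<close>, then \<open>a l\<close> would exceed \<open>8 T / l\<close> because
  \<open>(l + 1)\<^sup>2 \<le> l (l + 3)\<close>.
\<close>

lemma quadratic_recursion_harmonic_decay:
  fixes a :: "nat \<Rightarrow> real"
  assumes T: "0 \<le> T" and start: "a 1 \<le> T" and l: "1 \<le> l"
    and step: "\<And>i. 1 \<le> i \<Longrightarrow> i < l \<Longrightarrow> (a (Suc i))\<^sup>2 \<le> 4 * T * (a i - a (Suc i))"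
  shows "real l * a l \<le> 8 * T"
proof -
  have "1 \<le> i \<Longrightarrow> i \<le> l \<Longrightarrow> real i * a i \<le> 8 * T" for i
  proof (induction i rule: nat_induct_at_least)
    case base
    then show ?case using start T by simp
  next
    case (Suc i)
    have IH: "real i * a i \<le> 8 * T" and i: "1 \<le> i" "i < l"
      using Suc by auto
    show ?case
    proof (cases "T = 0")
      case True
      then show ?thesis using step[OF i] by simp
    next
      case False
      with T have "0 < T" by simp
      show ?thesis
      proof (rule ccontr)
        define q where "q = real (Suc i)"
        define b where "b = a (Suc i)"
        assume "\<not> real (Suc i) * a (Suc i) \<le> 8 * T"
        then have gt: "8 * T < q * b" by (simp add: q_def b_def)
        have q: "2 \<le> q" using i by (simp add: q_def)
        have sq: "b\<^sup>2 \<le> 4 * T * (a i - b)" using step[OF i] by (simp add: b_def)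
        have ih: "(q - 1) * a i \<le> 8 * T" using IH by (simp add: q_def)
        have "(8 * T) * (8 * T) < (q * b) * (q * b)"
          by (rule mult_strict_mono[OF gt gt]) (use gt \<open>0 < T\<close> in linarith)+
        also have "\<dots> = q\<^sup>2 * b\<^sup>2" by (simp add: power2_eq_square algebra_simps)
        also have "\<dots> \<le> q\<^sup>2 * (4 * T * (a i - b))"
          using sq by (intro mult_left_mono) auto
        finally have "T * 16 * T < T * (q\<^sup>2 * (a i - b))" by (simp add: algebra_simps)
        then have "16 * T < q\<^sup>2 * (a i - b)" using \<open>0 < T\<close> by simp
        moreover have "q * (8 * T) < q * (q * b)" using gt q by simp
        ultimately have "16 * T + 8 * T * q < q\<^sup>2 * a i"
          by (simp add: power2_eq_square algebra_simps)
        then have "(q - 1) * (16 * T + 8 * T * q) < (q - 1) * (q\<^sup>2 * a i)"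
          using q by simp
        also have "\<dots> = q\<^sup>2 * ((q - 1) * a i)" by simp
        also have "\<dots> \<le> q\<^sup>2 * (8 * T)" using ih by (intro mult_left_mono) auto
        finally have "T * (q - 2) < 0" by (simp add: power2_eq_square algebra_simps)
        then show False using q \<open>0 < T\<close> by (simp add: mult_less_0_iff)
      qed
    qed
  qed
  then show ?thesis using l by simp
qed

section \<open>Cutting-plane models of a composite convex function\<close>

text \<open>
  On the effective domain of \<open>h\<close> every extended real that occurs is finite. The capital letters
  name the real-valued versions, so that the analysis can be carried out in the field of reals.
\<close>

locale composite_problem =
  fixes n :: nat and f :: "real vec \<Rightarrow> ereal" and f' :: "real vec \<Rightarrow> real vec"
    and h :: "real vec \<Rightarrow> ereal" and Mf Mh :: real
  assumes basic: "basic_assumptions n f f' h Mf Mh"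
    and Mf_nonneg: "0 \<le> Mf" and Mh_nonneg: "0 \<le> Mh"
begin

abbreviation D :: "real vec set" where "D \<equiv> edom n h"

definition F :: "real vec \<Rightarrow> real" where "F x = real_of_ereal (f x)"
definition H :: "real vec \<Rightarrow> real" where "H x = real_of_ereal (h x)"
definition Phi :: "real vec \<Rightarrow> real" where "Phi x = F x + H x"
definition lin :: "real vec \<Rightarrow> real vec \<Rightarrow> real" where
  "lin x u = F x + scalar_prod (f' x) (u - x)"
definition cutmax :: "real vec set \<Rightarrow> real vec \<Rightarrow> real" where
  "cutmax C u = Max ((\<lambda>x. lin x u) ` C)"

lemma D_carrier: "x \<in> D \<Longrightarrow> x \<in> carrier_vec n"
  by (simp add: edom_def)

lemma h_real: "x \<in> D \<Longrightarrow> h x = ereal (H x)"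
  using basic unfolding basic_assumptions_def proper_fun_def edom_def H_def
  by (cases "h x") auto

lemma f_real: "x \<in> D \<Longrightarrow> f x = ereal (F x)"
  using basic unfolding basic_assumptions_def proper_fun_def edom_def F_def
  by (cases "f x") auto

lemma objective_real: "x \<in> D \<Longrightarrow> objective f h x = ereal (Phi x)"
  by (simp add: objective_def f_real h_real Phi_def)

lemma objective_outside:
  assumes "u \<in> carrier_vec n" "u \<notin> D"
  shows "objective f h u = \<infinity>"
  using assms basic unfolding basic_assumptions_def proper_fun_def edom_def objective_def
  by (cases "f u") auto

lemma grad_carrier: "x \<in> D \<Longrightarrow> f' x \<in> carrier_vec n"
  using basic by (auto simp: basic_assumptions_def subdiff_def)

lemma grad_bound: "x \<in> D \<Longrightarrow> vnorm (f' x) \<le> Mf"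
  using basic by (auto simp: basic_assumptions_def)

lemma lin_le:
  assumes "x \<in> D" "u \<in> D"
  shows "lin x u \<le> F u"
proof -
  have "f u \<ge> f x + ereal (scalar_prod (f' x) (u - x))"
    using basic assms D_carrier by (auto simp: basic_assumptions_def subdiff_def)
  then show ?thesis using assms by (simp add: f_real lin_def)
qed

lemma H_Lipschitz:
  assumes "u \<in> D" "v \<in> D"
  shows "H u - H v \<le> Mh * vnorm (u - v)"
proof -
  have "\<bar>h u - h v\<bar> \<le> ereal (Mh * vnorm (u - v))"
    using basic assms by (auto simp: basic_assumptions_def)
  then show ?thesis using assms by (simp add: h_real)
qed

lemma segment_H:
  assumes x: "x \<in> D" and u: "u \<in> D" and s: "0 < s" "s < 1"
  shows "(1 - s) \<cdot>\<^sub>v x + s \<cdot>\<^sub>v u \<in> D"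
    and "H ((1 - s) \<cdot>\<^sub>v x + s \<cdot>\<^sub>v u) \<le> (1 - s) * H x + s * H u"
proof -
  let ?p = "(1 - s) \<cdot>\<^sub>v x + s \<cdot>\<^sub>v u"
  have "h ?p \<le> ereal (1 - s) * h x + ereal s * h u"
    using basic x u s D_carrier by (auto simp: basic_assumptions_def convex_fun_def)
  then have le: "h ?p \<le> ereal ((1 - s) * H x + s * H u)"
    using x u by (simp add: h_real)
  show "?p \<in> D"
    using le_less_trans[OF le, of \<infinity>] D_carrier[OF x] D_carrier[OF u] by (simp add: edom_def)
  then show "H ?p \<le> (1 - s) * H x + s * H u"
    using le by (simp add: h_real)
qed

lemma lin_segment:
  assumes "y \<in> D" "x \<in> D" "u \<in> D"
  shows "lin y ((1 - s) \<cdot>\<^sub>v x + s \<cdot>\<^sub>v u) = (1 - s) * lin y x + s * lin y u"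
  using assms
  by (simp add: lin_def scalar_prod_segment[OF grad_carrier D_carrier D_carrier D_carrier]
      algebra_simps)

lemma lin_self [simp]: "x \<in> D \<Longrightarrow> lin x x = F x"
  using grad_carrier[of x] D_carrier[of x] by (simp add: lin_def)

lemma scalar_prod_grad_bound:
  assumes "x \<in> D" "w \<in> carrier_vec n"
  shows "\<bar>scalar_prod (f' x) w\<bar> \<le> Mf * vnorm w"
  using scalar_prod_Cauchy_Schwarz[OF grad_carrier[OF assms(1)] assms(2)]
    mult_right_mono[OF grad_bound[OF assms(1)] vnorm_nonneg[of w]] by linarith

lemma lin_Lipschitz:
  assumes "y \<in> D" "u \<in> D" "v \<in> D"
  shows "lin y u \<le> lin y v + Mf * vnorm (u - v)"
proof -
  have "scalar_prod (f' y) (u - y) = scalar_prod (f' y) (u - v) + scalar_prod (f' y) (v - y)"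
    using assms grad_carrier[OF assms(1)] D_carrier[of y] D_carrier[of u] D_carrier[of v]
    by (simp add: scalar_prod_minus_distrib[of _ n])
  moreover have "\<bar>scalar_prod (f' y) (u - v)\<bar> \<le> Mf * vnorm (u - v)"
    using assms D_carrier by (intro scalar_prod_grad_bound) auto
  ultimately show ?thesis by (simp add: lin_def)
qed

text \<open>
  The subgradient at \<open>u\<close> controls the growth of \<open>f\<close> from \<open>x\<close> to \<open>u\<close> and the subgradient at \<open>x\<close>
  the growth of the linearization, whence the factor 2.
\<close>

lemma linearization_error:
  assumes "x \<in> D" "u \<in> D"
  shows "F u - lin x u \<le> 2 * Mf * vnorm (u - x)"
proof -
  have "F u \<le> lin u x + Mf * vnorm (u - x)"
    using lin_Lipschitz[OF assms(2) assms(2) assms(1)] assms by simp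
  also have "lin u x \<le> F x" using assms by (simp add: lin_le)
  also have "F x \<le> lin x u + Mf * vnorm (x - u)"
    using lin_Lipschitz[OF assms(1) assms(1) assms(2)] assms by simp
  also have "vnorm (x - u) = vnorm (u - x)"
    using assms D_carrier by (intro vnorm_diff_commute) auto
  finally show ?thesis by simp
qed

lemma linearization_real: "x \<in> D \<Longrightarrow> linearization f f' x u = ereal (lin x u)"
  by (simp add: linearization_def lin_def f_real)

lemma cut_model_real:
  assumes "finite C" "C \<noteq> {}" "C \<subseteq> D"
  shows "cut_model f f' C u = ereal (cutmax C u)"
proof -
  have "(\<lambda>x. linearization f f' x u) ` C = ereal ` ((\<lambda>x. lin x u) ` C)"
    using assms(3) by (auto simp: linearization_real image_image intro!: image_cong)
  moreover have "mono ereal" by (simp add: mono_def)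
  ultimately show ?thesis
    using assms mono_Max_commute[of ereal "(\<lambda>x. lin x u) ` C"]
    by (simp add: cut_model_def cutmax_def)
qed

lemma lin_le_cutmax: "finite C \<Longrightarrow> y \<in> C \<Longrightarrow> lin y u \<le> cutmax C u"
  by (simp add: cutmax_def)

lemma cutmax_le_iff: "finite C \<Longrightarrow> C \<noteq> {} \<Longrightarrow> cutmax C u \<le> b \<longleftrightarrow> (\<forall>y\<in>C. lin y u \<le> b)"
  by (simp add: cutmax_def)

lemma cutmax_mono:
  "finite C \<Longrightarrow> A \<noteq> {} \<Longrightarrow> A \<subseteq> C \<Longrightarrow> cutmax A u \<le> cutmax C u"
  by (auto simp: cutmax_def intro: Max_mono)

lemma cutmax_le:
  "finite C \<Longrightarrow> C \<noteq> {} \<Longrightarrow> C \<subseteq> D \<Longrightarrow> u \<in> D \<Longrightarrow> cutmax C u \<le> F u"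
  by (auto simp: cutmax_le_iff intro: lin_le)

lemma cutmax_attained:
  assumes "finite C" "C \<noteq> {}"
  shows "{y \<in> C. lin y u = cutmax C u} \<noteq> {}"
proof -
  have "cutmax C u \<in> (\<lambda>x. lin x u) ` C"
    unfolding cutmax_def using assms by (intro Max_in) auto
  then show ?thesis by auto
qed

lemma cutmax_Lipschitz:
  assumes C: "finite C" "C \<noteq> {}" "C \<subseteq> D" and "u \<in> D" "v \<in> D"
  shows "cutmax C u \<le> cutmax C v + Mf * vnorm (u - v)"
proof -
  have "lin y u \<le> cutmax C v + Mf * vnorm (u - v)" if "y \<in> C" for y
    using lin_Lipschitz[of y u v] lin_le_cutmax[OF C(1) that, of v] that assms by force
  then show ?thesis using C by (simp add: cutmax_le_iff)
qed

section \<open>The prox subproblem\<close>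

definition prox_model :: "real \<Rightarrow> real vec \<Rightarrow> real vec set \<Rightarrow> real vec \<Rightarrow> real" where
  "prox_model lam c C u = cutmax C u + H u + (vnorm (u - c))\<^sup>2 / (2 * lam)"

lemma prox_minimizer_in_D:
  assumes C: "finite C" "C \<noteq> {}" "C \<subseteq> D"
    and x: "x \<in> argmin_set (carrier_vec n) (add_prox lam c (\<lambda>u. cut_model f f' C u + h u))"
  shows "x \<in> D"
proof -
  obtain y where y: "y \<in> C" using C by auto
  then have yD: "y \<in> D" using C by auto
  have "add_prox lam c (\<lambda>u. cut_model f f' C u + h u) x
      \<le> add_prox lam c (\<lambda>u. cut_model f f' C u + h u) y"
    using x yD D_carrier by (auto simp: argmin_set_def)
  then have "h x \<noteq> \<infinity>"
    using yD by (auto simp: add_prox_def cut_model_real[OF C] h_real)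
  then show ?thesis using x by (auto simp: argmin_set_def edom_def)
qed

lemma prox_minimizer_le:
  assumes C: "finite C" "C \<noteq> {}" "C \<subseteq> D"
    and x: "x \<in> argmin_set (carrier_vec n) (add_prox lam c (\<lambda>u. cut_model f f' C u + h u))"
    and u: "u \<in> D"
  shows "prox_model lam c C x \<le> prox_model lam c C u"
proof -
  have "add_prox lam c (\<lambda>u. cut_model f f' C u + h u) x
      \<le> add_prox lam c (\<lambda>u. cut_model f f' C u + h u) u"
    using x u D_carrier by (auto simp: argmin_set_def)
  then show ?thesis
    using u prox_minimizer_in_D[OF C x]
    by (simp add: add_prox_def cut_model_real[OF C] h_real prox_model_def)
qed

text \<open>
  The prox subproblem has quadratic growth around its minimizer, and dropping the inactive cuts
  preserves this: near \<open>x\<close> the inactive cuts lie strictly below the model, so on a short piece of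
  the segment from \<open>x\<close> to \<open>u\<close> only the active cuts matter, and convexity propagates the estimate
  from there to \<open>u\<close>. This is why keeping the active cuts is enough for the method.
\<close>

lemma prox_growth_active:
  assumes C: "finite C" "C \<noteq> {}" "C \<subseteq> D" and c: "c \<in> carrier_vec n" and lam: "0 < lam"
    and x: "x \<in> argmin_set (carrier_vec n) (add_prox lam c (\<lambda>u. cut_model f f' C u + h u))"
    and u: "u \<in> D"
  defines "A \<equiv> {y \<in> C. lin y x = cutmax C x}"
  shows "prox_model lam c C x + (vnorm (u - x))\<^sup>2 / (2 * lam) \<le> prox_model lam c A u"
proof -
  have xD: "x \<in> D" by (rule prox_minimizer_in_D[OF C x])
  define p where "p s = (1 - s) \<cdot>\<^sub>v x + s \<cdot>\<^sub>v u" for s :: real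
  define V where "V = prox_model lam c C x"
  define W where "W = prox_model lam c A u"
  define Q where "Q = (vnorm (u - x))\<^sup>2 / (2 * lam)"
  have A: "finite A" "A \<noteq> {}"
    using C cutmax_attained[OF C(1,2)] by (auto simp: A_def)
  have each: "\<forall>\<^sub>F s in at_right 0. lin y (p s) \<le> (1 - s) * cutmax C x + s * cutmax A u"
    if y: "y \<in> C" for y
  proof -
    have yD: "y \<in> D" using y C by auto
    have eq: "lin y (p s) = (1 - s) * lin y x + s * lin y u" for s
      unfolding p_def by (rule lin_segment[OF yD xD u])
    show ?thesis
    proof (cases "y \<in> A")
      case True
      have "\<forall>\<^sub>F s :: real in at_right 0. 0 < s" by (simp add: eventually_at_right_less)
      then show ?thesis
      proof eventually_elim
        case (elim s)
        have "s * lin y u \<le> s * cutmax A u"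
          using elim lin_le_cutmax[OF A(1) True] by (intro mult_left_mono) auto
        then show ?case using True by (simp add: eq A_def)
      qed
    next
      case False
      then have less: "lin y x < cutmax C x"
        using lin_le_cutmax[OF C(1) y, of x] y by (auto simp: A_def)
      have "((\<lambda>s. ((1 - s) * cutmax C x + s * cutmax A u) - ((1 - s) * lin y x + s * lin y u))
          \<longlongrightarrow> ((1 - 0) * cutmax C x + 0 * cutmax A u) - ((1 - 0) * lin y x + 0 * lin y u))
          (at_right 0)"
        by (intro tendsto_intros)
      then have "\<forall>\<^sub>F s in at_right 0.
          0 < ((1 - s) * cutmax C x + s * cutmax A u) - ((1 - s) * lin y x + s * lin y u)"
        using less by (intro order_tendstoD) auto
      then show ?thesis by eventually_elim (simp add: eq)
    qed
  qed
  have small: "\<forall>\<^sub>F s :: real in at_right 0. 0 < s \<and> s < 1"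
    by (auto simp: eventually_at_right_field intro!: exI[of _ 1])
  have "\<forall>\<^sub>F s in at_right 0. \<forall>y\<in>C. lin y (p s) \<le> (1 - s) * cutmax C x + s * cutmax A u"
    using each C(1) by (simp add: eventually_ball_finite_distrib)
  with small have ev: "\<forall>\<^sub>F s in at_right 0. V \<le> W - (1 - s) * Q"
  proof eventually_elim
    case (elim s)
    have s: "0 < s" "s < 1" using elim by auto
    have pD: "p s \<in> D" and Hp: "H (p s) \<le> (1 - s) * H x + s * H u"
      using segment_H[OF xD u s] by (auto simp: p_def)
    have cut: "cutmax C (p s) \<le> (1 - s) * cutmax C x + s * cutmax A u"
      using elim C by (simp add: cutmax_le_iff)
    have nrm: "(vnorm (p s - c))\<^sup>2 / (2 * lam) =
      (1 - s) * ((vnorm (x - c))\<^sup>2 / (2 * lam)) + s * ((vnorm (u - c))\<^sup>2 / (2 * lam)) - s * (1 - s) * Q"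
      unfolding p_def vnorm_power2_segment[OF D_carrier[OF xD] D_carrier[OF u] c] Q_def
      by (simp add: add_divide_distrib diff_divide_distrib)
    have "V \<le> prox_model lam c C (p s)"
      unfolding V_def by (rule prox_minimizer_le[OF C x pD])
    also have "\<dots> \<le> (1 - s) * V + s * W - s * (1 - s) * Q"
      using cut Hp unfolding prox_model_def V_def W_def nrm by (simp add: algebra_simps)
    finally have "s * V \<le> s * (W - (1 - s) * Q)" by (simp add: algebra_simps)
    then show ?case using s by simp
  qed
  have "((\<lambda>s. W - (1 - s) * Q) \<longlongrightarrow> W - (1 - 0) * Q) (at_right 0)"
    by (intro tendsto_intros)
  then have "V \<le> W - (1 - 0) * Q"
    by (rule tendsto_lowerbound[OF _ ev]) simp
  then show ?thesis by (simp add: V_def W_def Q_def)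
qed

lemma prox_growth:
  assumes C: "finite C" "C \<noteq> {}" "C \<subseteq> D" and c: "c \<in> carrier_vec n" and lam: "0 < lam"
    and x: "x \<in> argmin_set (carrier_vec n) (add_prox lam c (\<lambda>u. cut_model f f' C u + h u))"
    and u: "u \<in> D"
  shows "prox_model lam c C x + (vnorm (u - x))\<^sup>2 / (2 * lam) \<le> prox_model lam c C u"
proof -
  have "cutmax {y \<in> C. lin y x = cutmax C x} u \<le> cutmax C u"
    using C cutmax_attained[OF C(1,2)] by (intro cutmax_mono) auto
  then show ?thesis
    using prox_growth_active[OF assms] by (simp add: prox_model_def)
qed

text \<open>
  Quadratic growth, tested at the center, bounds the squared displacement by the decrease of the
  \<open>(Mf + Mh)\<close>-Lipschitz function \<open>cutmax C + H\<close> along it.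
\<close>

lemma prox_displacement:
  assumes C: "finite C" "C \<noteq> {}" "C \<subseteq> D" and c: "c \<in> D" and lam: "0 < lam"
    and x: "x \<in> argmin_set (carrier_vec n) (add_prox lam c (\<lambda>u. cut_model f f' C u + h u))"
  shows "vnorm (x - c) \<le> lam * (Mf + Mh)"
proof -
  have xD: "x \<in> D" by (rule prox_minimizer_in_D[OF C x])
  define d where "d = vnorm (x - c)"
  have sym: "vnorm (c - x) = d"
    unfolding d_def using c xD D_carrier by (intro vnorm_diff_commute) auto
  have "prox_model lam c C x + d\<^sup>2 / (2 * lam) \<le> prox_model lam c C c"
    using prox_growth[OF C D_carrier[OF c] lam x c] sym by simp
  moreover have "cutmax C c \<le> cutmax C x + Mf * d"
    using cutmax_Lipschitz[OF C c xD] sym by simp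
  moreover have "H c - H x \<le> Mh * d"
    using H_Lipschitz[OF c xD] sym by simp
  ultimately have "d\<^sup>2 / (2 * lam) + d\<^sup>2 / (2 * lam) \<le> (Mf + Mh) * d"
    by (simp add: prox_model_def d_def algebra_simps)
  then have "d * d \<le> lam * (Mf + Mh) * d"
    using lam by (simp add: field_simps power2_eq_square)
  moreover have "0 \<le> lam * (Mf + Mh)"
    using lam Mf_nonneg Mh_nonneg by simp
  ultimately show ?thesis
    by (cases "d = 0") (auto simp: d_def less_le)
qed

end

section \<open>Null steps and the length of a cycle\<close>

locale rpb_execution = composite_problem +
  fixes x0 :: "real vec" and lam \<delta> :: real and R :: rpb_trace
  assumes x0_D: "x0 \<in> D" and lam_pos: "0 < lam" and \<delta>_pos: "0 < \<delta>"
    and run: "rpb_run n f f' h x0 lam \<delta> R"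
begin

abbreviation S :: "nat set" where "S \<equiv> serious_indices f f' h lam \<delta> R"

lemma run_start:
  "iter R 0 = x0" "center R 0 = x0" "best R 0 = x0" "zhat R 0 = x0" "cuts R (Suc 0) = {x0}"
  "counter R 0 = 1"
  using run by (auto simp: rpb_run_def)

lemma iter_argmin:
  assumes "1 \<le> j"
  shows "iter R j \<in> argmin_set (carrier_vec n)
    (add_prox lam (center R (j - 1)) (\<lambda>u. cut_model f f' (cuts R j) u + h u))"
  using run assms unfolding rpb_run_def model_prox_def model_fun_def by blast

lemma best_argmin:
  assumes "1 \<le> j"
  shows "best R j \<in> argmin_set {iter R j, best R (j - 1)} (objective_prox f h lam R j)"
  using run assms unfolding rpb_run_def by blast

lemma serious_0: "0 \<in> S"
  by (simp add: serious_indices_def)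

lemma serious_stepI: "j \<in> S \<Longrightarrow> 1 \<le> j \<Longrightarrow> serious_step f h R j"
  using run by (auto simp: rpb_run_def serious_indices_def)

lemma null_stepI:
  assumes "j \<notin> S"
  shows "1 \<le> j" "null_step f f' R j"
  using run assms by (auto simp: rpb_run_def serious_indices_def)

text \<open>
  Cut sets are built from earlier iterates, and iterates stay in the domain of \<open>h\<close> as soon as the
  cuts do, so the invariants have to be proved by one simultaneous induction.
\<close>

lemma execution_wellformed:
  "finite (cuts R (Suc j)) \<and> iter R j \<in> cuts R (Suc j) \<and> cuts R (Suc j) \<subseteq> D \<and>
   (\<forall>i\<le>j. iter R i \<in> D) \<and> center R j \<in> D \<and> best R j \<in> D"
proof (induction j)
  case 0
  then show ?case using x0_D by (simp add: run_start)
next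
  case (Suc j)
  have "iter R (Suc j) \<in> D"
    using Suc iter_argmin[of "Suc j"] by (intro prox_minimizer_in_D[of "cuts R (Suc j)"]) auto
  with Suc have iters: "\<forall>i\<le>Suc j. iter R i \<in> D" by (auto simp: le_Suc_eq)
  have "best R (Suc j) \<in> {iter R (Suc j), best R j}"
    using best_argmin[of "Suc j"] by (auto simp: argmin_set_def)
  then have best: "best R (Suc j) \<in> D" using Suc iters by auto
  show ?case
  proof (cases "Suc j \<in> S")
    case True
    then have "serious_step f h R (Suc j)" by (intro serious_stepI) auto
    then have ss: "finite (cuts R (Suc (Suc j)))" "iter R (Suc j) \<in> cuts R (Suc (Suc j))"
      "cuts R (Suc (Suc j)) \<subseteq> iter R ` {0..Suc j}" "center R (Suc j) = iter R (Suc j)"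
      unfolding serious_step_def by auto
    have "cuts R (Suc (Suc j)) \<subseteq> D" using ss(3) iters by auto
    then show ?thesis using ss(1,2,4) iters best by auto
  next
    case False
    then have "null_step f f' R (Suc j)" by (intro null_stepI)
    then have ns: "iter R (Suc j) \<in> cuts R (Suc (Suc j))"
      "cuts R (Suc (Suc j)) \<subseteq> cuts R (Suc j) \<union> {iter R (Suc j)}" "center R (Suc j) = center R j"
      unfolding null_step_def by auto
    have "finite (cuts R (Suc (Suc j)))"
      using ns(2) Suc by (auto intro: finite_subset)
    moreover have "cuts R (Suc (Suc j)) \<subseteq> D" using ns(2) Suc iters by blast
    ultimately show ?thesis using ns(1,3) iters best Suc by auto
  qed
qed

lemma iter_D: "iter R j \<in> D" and center_D: "center R j \<in> D" and best_D: "best R j \<in> D"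
  using execution_wellformed[of j] by auto

lemma cuts_wellformed:
  assumes "1 \<le> j"
  shows "finite (cuts R j)" "cuts R j \<noteq> {}" "cuts R j \<subseteq> D" "iter R (j - 1) \<in> cuts R j"
  using execution_wellformed[of "j - 1"] assms by auto

text \<open>
  \<open>psi j\<close>, \<open>mval j\<close> and \<open>tau j\<close> are the real versions of \<open>\<phi>_j^\<lambda>\<close>, \<open>m_j\<close> and \<open>t_j\<close>.
\<close>

definition psi :: "nat \<Rightarrow> real vec \<Rightarrow> real" where
  "psi j u = Phi u + (vnorm (u - center R (j - 1)))\<^sup>2 / (2 * lam)"

definition mval :: "nat \<Rightarrow> real" where
  "mval j = prox_model lam (center R (j - 1)) (cuts R j) (iter R j)"

definition tau :: "nat \<Rightarrow> real" where
  "tau j = psi j (best R j) - mval j"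

lemma model_prox_real:
  assumes "1 \<le> j"
  shows "model_prox f f' h lam R j (iter R j) = ereal (mval j)"
  using cuts_wellformed[OF assms] iter_D
  by (simp add: model_prox_def model_fun_def add_prox_def cut_model_real h_real mval_def
      prox_model_def)

lemma objective_prox_real: "u \<in> D \<Longrightarrow> objective_prox f h lam R j u = ereal (psi j u)"
  by (simp add: objective_prox_def add_prox_def objective_real psi_def)

lemma gap_real: "1 \<le> j \<Longrightarrow> gap f f' h lam R j = ereal (tau j)"
  by (simp add: gap_def model_prox_real objective_prox_real best_D tau_def)

lemma tau_serious: "j \<in> S \<Longrightarrow> 1 \<le> j \<Longrightarrow> tau j \<le> \<delta>"
  by (auto simp: serious_indices_def gap_real)

lemma tau_null: "j \<notin> S \<Longrightarrow> \<delta> < tau j"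
  using null_stepI(1)[of j] by (auto simp: serious_indices_def gap_real)

lemma psi_best_le:
  assumes "1 \<le> j" "u \<in> {iter R j, best R (j - 1)}"
  shows "psi j (best R j) \<le> psi j u"
proof -
  have "u \<in> D" using assms iter_D best_D by auto
  moreover have "objective_prox f h lam R j (best R j) \<le> objective_prox f h lam R j u"
    using best_argmin[OF assms(1)] assms(2) by (auto simp: argmin_set_def)
  ultimately show ?thesis by (simp add: objective_prox_real best_D)
qed

text \<open>
  Every cut lies below \<open>f\<close>, so the quadratic growth of the prox model carries over to the
  regularized objective itself.
\<close>

lemma mval_growth:
  assumes "1 \<le> j" "u \<in> D"
  shows "mval j + (vnorm (u - iter R j))\<^sup>2 / (2 * lam) \<le> psi j u"
proof -
  note C = cuts_wellformed[OF assms(1)]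
  have "mval j + (vnorm (u - iter R j))\<^sup>2 / (2 * lam)
      \<le> prox_model lam (center R (j - 1)) (cuts R j) u"
    unfolding mval_def
    by (rule prox_growth[OF C(1-3) D_carrier[OF center_D] lam_pos iter_argmin[OF assms(1)] assms(2)])
  also have "\<dots> \<le> psi j u"
    using cutmax_le[OF C(1-3) assms(2)] by (simp add: prox_model_def psi_def Phi_def)
  finally show ?thesis .
qed

lemma best_close_to_iter:
  assumes "1 \<le> j"
  shows "(vnorm (best R j - iter R j))\<^sup>2 / (2 * lam) \<le> tau j"
  using mval_growth[OF assms best_D[of j]] by (simp add: tau_def)

lemma tau_nonneg: "1 \<le> j \<Longrightarrow> 0 \<le> tau j"
  using best_close_to_iter[of j] lam_pos 
  by (smt (verit) divide_nonneg_pos zero_le_power2)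

text \<open>
  The previous iterate is always among the cuts, so the model error at the new iterate is at most
  the linearization error from one iterate to the next. This includes the first iteration of a
  cycle, whose predecessor is the new center.
\<close>

lemma tau_le_step:
  assumes "1 \<le> j"
  shows "tau j \<le> 2 * Mf * vnorm (iter R j - iter R (j - 1))"
proof -
  note C = cuts_wellformed[OF assms]
  have "tau j \<le> psi j (iter R j) - mval j"
    using psi_best_le[OF assms] by (simp add: tau_def)
  also have "\<dots> = F (iter R j) - cutmax (cuts R j) (iter R j)"
    by (simp add: psi_def mval_def prox_model_def Phi_def)
  also have "\<dots> \<le> F (iter R j) - lin (iter R (j - 1)) (iter R j)"
    using lin_le_cutmax[OF C(1) C(4)] by simp
  also have "\<dots> \<le> 2 * Mf * vnorm (iter R j - iter R (j - 1))"
    by (intro linearization_error iter_D)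
  finally show ?thesis .
qed

lemma null_step_decrease:
  assumes "j \<notin> S"
  shows "tau (Suc j) + (vnorm (iter R (Suc j) - iter R j))\<^sup>2 / (2 * lam) \<le> tau j"
proof -
  have j: "1 \<le> j" and ns: "null_step f f' R j" using null_stepI[OF assms] by auto
  note C = cuts_wellformed[OF j]
  define A where "A = {y \<in> cuts R j. lin y (iter R j) = cutmax (cuts R j) (iter R j)}"
  have cen: "center R j = center R (j - 1)" using ns by (simp add: null_step_def)
  have "A \<subseteq> active_cuts f f' R j"
    using C by (auto simp: A_def active_cuts_def model_fun_def cut_model_real linearization_real)
  then have sub: "A \<subseteq> cuts R (Suc j)" using ns by (auto simp: null_step_def)
  have "A \<noteq> {}" unfolding A_def by (rule cutmax_attained[OF C(1,2)])
  then have mono: "cutmax A u \<le> cutmax (cuts R (Suc j)) u" for u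
    using sub cuts_wellformed(1)[of "Suc j"] by (intro cutmax_mono) auto
  have "mval j + (vnorm (iter R (Suc j) - iter R j))\<^sup>2 / (2 * lam)
      \<le> prox_model lam (center R (j - 1)) A (iter R (Suc j))"
    unfolding mval_def A_def
    by (rule prox_growth_active[OF C(1-3) D_carrier[OF center_D] lam_pos iter_argmin[OF j] iter_D])
  also have "\<dots> \<le> mval (Suc j)"
    using mono[of "iter R (Suc j)"] by (simp add: mval_def prox_model_def cen)
  finally have "mval j + (vnorm (iter R (Suc j) - iter R j))\<^sup>2 / (2 * lam) \<le> mval (Suc j)" .
  moreover have "psi (Suc j) (best R (Suc j)) \<le> psi j (best R j)"
    using psi_best_le[of "Suc j" "best R j"] by (simp add: psi_def cen)
  ultimately show ?thesis by (simp add: tau_def)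
qed

lemma center_serious: "s \<in> S \<Longrightarrow> center R s = iter R s"
  using serious_stepI[of s] run_start by (cases "s = 0") (auto simp: serious_step_def)

lemma constant_on_cycle:
  assumes "s \<in> S" "s \<le> j" "\<And>i. s < i \<Longrightarrow> i \<le> j \<Longrightarrow> i \<notin> S"
  shows "center R j = iter R s \<and> counter R j = counter R s"
  using assms(2,3)
proof (induction j rule: dec_induct)
  case base
  then show ?case using center_serious[OF assms(1)] by simp
next
  case (step j)
  then have "null_step f f' R (Suc j)" by (intro null_stepI) auto
  then show ?case using step by (auto simp: null_step_def)
qed

text \<open>
  Within a cycle a null step decreases the gap by the squared step length over \<open>2 lam\<close>, while the
  next gap is at most \<open>2 Mf\<close> times the step length. Eliminating the step length gives the
  quadratic recursion. Its initial value is controlled because the cycle starts with the cut at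
  its own center, within distance \<open>lam (Mf + Mh)\<close> of the first iterate.
\<close>

lemma cycle_gap_decay:
  assumes s: "s \<in> S" and l: "1 \<le> l" and null: "\<And>i. s < i \<Longrightarrow> i < s + l \<Longrightarrow> i \<notin> S"
  shows "real l * tau (s + l) \<le> 8 * (2 * lam * (Mf + Mh) * Mf)"
proof -
  define T where "T = 2 * lam * (Mf + Mh) * Mf"
  have T: "0 \<le> T" using lam_pos Mf_nonneg Mh_nonneg by (simp add: T_def)
  have start: "tau (s + 1) \<le> T"
  proof -
    note C = cuts_wellformed[of "Suc s"]
    have "vnorm (iter R (Suc s) - center R s) \<le> lam * (Mf + Mh)"
      using prox_displacement[OF C(1-3) center_D lam_pos iter_argmin[of "Suc s"]] by simp
    then have "vnorm (iter R (Suc s) - iter R s) \<le> lam * (Mf + Mh)"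
      by (simp add: center_serious[OF s])
    then have "2 * Mf * vnorm (iter R (Suc s) - iter R s) \<le> 2 * Mf * (lam * (Mf + Mh))"
      using Mf_nonneg by (intro mult_left_mono) auto
    then show ?thesis using tau_le_step[of "Suc s"] by (simp add: T_def algebra_simps)
  qed
  have step: "(tau (s + Suc i))\<^sup>2 \<le> 4 * T * (tau (s + i) - tau (s + Suc i))"
    if i: "1 \<le> i" "i < l" for i
  proof -
    define d where "d = vnorm (iter R (Suc (s + i)) - iter R (s + i))"
    have "s + i \<notin> S" using i by (intro null) auto
    from null_step_decrease[OF this]
    have dec: "d\<^sup>2 \<le> 2 * lam * (tau (s + i) - tau (s + Suc i))"
      using lam_pos by (simp add: d_def field_simps)
    have "(tau (s + Suc i))\<^sup>2 \<le> (2 * Mf * d)\<^sup>2"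
      using tau_le_step[of "s + Suc i"] tau_nonneg[of "s + Suc i"]
      by (intro power_mono) (auto simp: d_def)
    also have "\<dots> = 4 * Mf\<^sup>2 * d\<^sup>2" by (simp add: power_mult_distrib)
    also have "\<dots> \<le> 4 * (Mf * (Mf + Mh)) * (2 * lam * (tau (s + i) - tau (s + Suc i)))"
      using dec Mf_nonneg Mh_nonneg
      by (intro mult_mono) (auto simp: power2_eq_square intro!: mult_left_mono)
    also have "\<dots> = 4 * T * (tau (s + i) - tau (s + Suc i))"
      by (simp add: T_def algebra_simps)
    finally show ?thesis .
  qed
  have "real l * tau (s + l) \<le> 8 * T"
    by (rule quadratic_recursion_harmonic_decay[where a = "\<lambda>i. tau (s + i)", OF T start l step])
  then show ?thesis by (simp add: T_def)
qed

definition null_bound :: real where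
  "null_bound = 16 * lam * (Mf + Mh) * Mf / \<delta>"

lemma null_bound_nonneg: "0 \<le> null_bound"
  using lam_pos \<delta>_pos Mf_nonneg Mh_nonneg by (simp add: null_bound_def)

lemma cycle_null_steps:
  assumes s: "s \<in> S" and null: "\<And>i. s < i \<Longrightarrow> i \<le> s + l \<Longrightarrow> i \<notin> S"
  shows "real l \<le> null_bound"
proof (cases "l = 0")
  case True
  then show ?thesis using null_bound_nonneg by simp
next
  case False
  have "real l * \<delta> \<le> real l * tau (s + l)"
    using tau_null[of "s + l"] null[of "s + l"] False by (intro mult_left_mono) auto
  also have "\<dots> \<le> 8 * (2 * lam * (Mf + Mh) * Mf)"
    using False null by (intro cycle_gap_decay[OF s]) auto
  finally show ?thesis using \<delta>_pos by (simp add: null_bound_def field_simps)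
qed

text \<open>
  A last serious index would be followed by an unbounded run of null steps.
\<close>

lemma infinite_serious: "infinite S"
proof
  assume fin: "finite S"
  define s where "s = Max S"
  have s: "s \<in> S" unfolding s_def using fin serious_0 by (intro Max_in) auto
  have late: "i \<notin> S" if "s < i" for i
    using that Max_ge[OF fin, of i] by (auto simp: s_def)
  obtain l where "null_bound < real l" using reals_Archimedean2 by blast
  moreover have "real l \<le> null_bound" by (rule cycle_null_steps[OF s]) (use late in auto)
  ultimately show False by simp
qed

section \<open>Serious steps and the solution triples\<close>

definition J :: "nat \<Rightarrow> nat" where "J = enumerate S"

lemma J_0: "J 0 = 0"
  using serious_0 by (simp add: J_def enumerate_0)

lemma J_serious: "J k \<in> S"
  unfolding J_def by (rule enumerate_in_set[OF infinite_serious])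

lemma J_step: "J k < J (Suc k)"
  unfolding J_def by (rule enumerate_step[OF infinite_serious])

lemma J_between:
  assumes "J k < i" "i < J (Suc k)"
  shows "i \<notin> S"
proof
  assume "i \<in> S"
  then have "(LEAST s. s \<in> S \<and> J k < s) \<le> i" using assms(1) by (intro Least_le) auto
  then show False
    using assms(2) enumerate_Suc''[OF infinite_serious, of k] by (simp add: J_def)
qed

lemma J_ge_1: "1 \<le> k \<Longrightarrow> 1 \<le> J k"
  using J_step[of "k - 1"] by (cases k) auto

lemma J_bound: "real (J k) \<le> real k * (1 + null_bound)"
proof (induction k)
  case 0
  then show ?case by (simp add: J_0)
next
  case (Suc k)
  have "real (J (Suc k) - 1 - J k) \<le> null_bound"
    using J_step[of k] by (intro cycle_null_steps[OF J_serious, of k] J_between) auto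
  moreover have "real (J (Suc k) - 1 - J k) = real (J (Suc k)) - 1 - real (J k)"
    using J_step[of k] by simp
  ultimately show ?case using Suc by (simp add: algebra_simps)
qed

lemma before_serious: "center R (J (Suc k) - 1) = iter R (J k) \<and> counter R (J (Suc k) - 1) = counter R (J k)"
  using J_step[of k] by (intro constant_on_cycle J_serious J_between) auto

text \<open>
  The counter starts at 1 and grows only at serious steps, so it runs one ahead of the index \<open>k\<close>.
\<close>

lemma counter_J: "counter R (J k) = Suc k"
proof (induction k)
  case 0
  then show ?case by (simp add: J_0 run_start)
next
  case (Suc k)
  have "serious_step f h R (J (Suc k))" by (intro serious_stepI J_serious J_ge_1) simp
  then show ?case using before_serious[of k] Suc by (simp add: serious_step_def Let_def)
qed

lemma zhat_argmin: "zhat R (Suc k) \<in> argmin_set {zhat R k, best R (J (Suc k))} (objective f h)"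
proof -
  have "serious_step f h R (J (Suc k))" by (intro serious_stepI J_serious J_ge_1) simp
  then show ?thesis
    using before_serious[of k] counter_J[of k] by (simp add: serious_step_def Let_def)
qed

lemma zhat_cases: "zhat R k = x0 \<or> (\<exists>i. 1 \<le> i \<and> i \<le> k \<and> zhat R k = best R (J i))"
proof (induction k)
  case 0
  then show ?case by (simp add: run_start)
next
  case (Suc k)
  have "zhat R (Suc k) = zhat R k \<or> zhat R (Suc k) = best R (J (Suc k))"
    using zhat_argmin[of k] by (auto simp: argmin_set_def)
  then show ?case using Suc by (metis le_Suc_eq le_add1 plus_1_eq_Suc)
qed

lemma zhat_D: "zhat R k \<in> D"
  using zhat_cases[of k] x0_D best_D by auto

lemma zhat_step_le:
  "Phi (zhat R (Suc k)) \<le> Phi (zhat R k)" "Phi (zhat R (Suc k)) \<le> Phi (best R (J (Suc k)))"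
  using zhat_argmin[of k] by (auto simp: argmin_set_def objective_real zhat_D best_D)

abbreviation dlt :: "nat \<Rightarrow> real" where "dlt \<equiv> delta_k f f' h lam R J"

lemma delta_k_real:
  "dlt (Suc k) = Phi (best R (J (Suc k))) - mval (J (Suc k))"
proof -
  have j: "1 \<le> J (Suc k)" by (rule J_ge_1) simp
  show ?thesis
    using cuts_wellformed[OF j] before_serious[of k] iter_D best_D
    by (simp add: delta_k_def objective_real model_fun_def cut_model_real h_real mval_def
        prox_model_def)
qed

lemma delta_k_le: "dlt (Suc k) \<le> \<delta>"
proof -
  have "tau (J (Suc k)) \<le> \<delta>" by (intro tau_serious J_serious J_ge_1) simp
  then show ?thesis
    using lam_pos unfolding delta_k_real tau_def psi_def
    by (smt (verit) divide_nonneg_pos zero_le_power2)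
qed

lemma sum_delta_k_le: "(\<Sum>i = 1..k. dlt i) \<le> real k * \<delta>"
proof -
  have "dlt i \<le> \<delta>" if "i \<in> {1..k}" for i
    using delta_k_le[of "i - 1"] that by simp
  then show ?thesis using sum_bounded_above[of "{1..k}" dlt \<delta>] by simp
qed

text \<open>
  Each serious step is an inexact proximal step: quadratic growth of its subproblem yields
  \<open>Phi u \<ge> Phi (best R (J i)) - dlt i + (|u - z_i|\<^sup>2 - |u - z_(i-1)|\<^sup>2) / (2 lam)\<close> with
  \<open>z_i = iter R (J i)\<close>. Summing over \<open>i\<close> telescopes the squared distances, and
  \<^term>\<open>zhat R k\<close> is at least as good as every \<^term>\<open>best R (J i)\<close> with \<open>i \<le> k\<close>.
\<close>

lemma averaged_prox_inequality:
  assumes u: "u \<in> D"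
  shows "real k * Phi (zhat R k) - (\<Sum>i = 1..k. dlt i)
      + ((vnorm (u - iter R (J k)))\<^sup>2 - (vnorm (u - x0))\<^sup>2) / (2 * lam) \<le> real k * Phi u"
proof (induction k)
  case 0
  then show ?case by (simp add: J_0 run_start)
next
  case (Suc k)
  have "mval (J (Suc k)) + (vnorm (u - iter R (J (Suc k))))\<^sup>2 / (2 * lam)
      \<le> Phi u + (vnorm (u - iter R (J k)))\<^sup>2 / (2 * lam)"
    using mval_growth[OF J_ge_1 u, of "Suc k"] before_serious[of k] by (simp add: psi_def)
  moreover have "real k * Phi (zhat R (Suc k)) \<le> real k * Phi (zhat R k)"
    by (intro mult_left_mono zhat_step_le) simp
  ultimately show ?case
    using Suc zhat_step_le(2)[of k] delta_k_real[of k]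
    by (simp add: diff_divide_distrib algebra_simps)
qed

text \<open>
  By \<open>vnorm_power2_diff_affine\<close> the averaged inequality has an affine function of \<open>u\<close> on one side.
  Divided by \<open>k\<close> and expanded at \<^term>\<open>zhat R k\<close>, it has slope \<^term>\<open>vhat lam R J k\<close> and value
  \<open>Phi (zhat R k) - epshat f f' h lam R J k\<close> there.
\<close>

lemma vhat_eps_subgradient:
  assumes k: "1 \<le> k"
  shows "vhat lam R J k \<in>
    eps_subdiff n (objective f h) (epshat f f' h lam R J k) (zhat R k)"
proof -
  let ?v = "vhat lam R J k" and ?e = "epshat f f' h lam R J k" and ?z = "zhat R k"
  note car = D_carrier[OF iter_D[of "J k"]] D_carrier[OF zhat_D[of k]] D_carrier[OF x0_D]
  have vc: "?v \<in> carrier_vec n" using car by (auto simp: vhat_def J_0 run_start)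
  have real_ineq: "Phi ?z + scalar_prod ?v (u - ?z) - ?e \<le> Phi u" if u: "u \<in> D" for u
  proof -
    have "real k * scalar_prod ?v (u - ?z) = scalar_prod (x0 - iter R (J k)) (u - ?z) / lam"
      using k lam_pos car D_carrier[OF u]
      by (simp add: vhat_def J_0 run_start smult_scalar_prod_distrib[of _ n] field_simps)
    moreover have "real k * ?e = (\<Sum>i = 1..k. dlt i)
        + ((vnorm (?z - x0))\<^sup>2 - (vnorm (?z - iter R (J k)))\<^sup>2) / (2 * lam)"
      using k lam_pos by (simp add: epshat_def J_0 run_start field_simps)
    moreover have "((vnorm (u - iter R (J k)))\<^sup>2 - (vnorm (u - x0))\<^sup>2) / (2 * lam) =
        ((vnorm (?z - iter R (J k)))\<^sup>2 - (vnorm (?z - x0))\<^sup>2) / (2 * lam)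
        + scalar_prod (x0 - iter R (J k)) (u - ?z) / lam"
      unfolding vnorm_power2_diff_affine[OF D_carrier[OF u] car(2,1,3)]
      using lam_pos by (simp add: field_simps)
    ultimately have "real k * (Phi ?z + scalar_prod ?v (u - ?z) - ?e) \<le> real k * Phi u"
      using averaged_prox_inequality[OF u, of k]
      by (simp add: diff_divide_distrib algebra_simps)
    then show ?thesis using k by simp
  qed
  have "objective f h ?z + ereal (scalar_prod ?v (u - ?z)) - ereal ?e \<le> objective f h u"
    if u: "u \<in> carrier_vec n" for u
  proof (cases "u \<in> D")
    case True
    then show ?thesis using real_ineq[OF True] by (simp add: objective_real zhat_D)
  next
    case False
    then show ?thesis using u by (simp add: objective_outside)
  qed
  then show ?thesis using vc by (simp add: eps_subdiff_def)
qed

section \<open>Distances to the solution set\<close>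

abbreviation solutions :: "real vec set" where
  "solutions \<equiv> argmin_set (carrier_vec n) (objective f h)"

abbreviation d0 :: real where "d0 \<equiv> dist_opt n f h x0"

definition rad :: real where "rad = sqrt (2 * lam * \<delta>)"

lemma rad_nonneg: "0 \<le> rad" and rad_power2: "rad\<^sup>2 = 2 * lam * \<delta>"
  using lam_pos \<delta>_pos by (auto simp: rad_def)

lemma solution_D:
  assumes "y \<in> solutions"
  shows "y \<in> D" and "u \<in> D \<Longrightarrow> Phi y \<le> Phi u"
proof -
  have le: "objective f h y \<le> objective f h u" if "u \<in> D" for u
    using assms that D_carrier by (auto simp: argmin_set_def)
  show "y \<in> D"
    using le[OF x0_D] assms objective_outside[of y]
    by (cases "y \<in> D") (auto simp: argmin_set_def objective_real x0_D)
  then show "u \<in> D \<Longrightarrow> Phi y \<le> Phi u" using le[of u] by (simp add: objective_real)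
qed

lemma solutions_nonempty: "solutions \<noteq> {}"
  using basic by (simp add: basic_assumptions_def)

lemma d0_nonneg: "0 \<le> d0"
  unfolding dist_opt_def by (rule cINF_greatest[OF solutions_nonempty]) simp

text \<open>
  Testing the averaged inequality at a minimizer \<open>y\<close> shows that \<open>|z_k - y|\<^sup>2\<close> exceeds
  \<open>|x0 - y|\<^sup>2\<close> by at most \<open>k rad\<^sup>2\<close>.
\<close>

lemma serious_iterate_distance: "vnorm (iter R (J k) - x0) \<le> 2 * d0 + sqrt (real k) * rad"
proof -
  have "vnorm (iter R (J k) - x0) \<le> 2 * vnorm (x0 - y) + sqrt (real k) * rad"
    if y: "y \<in> solutions" for y
  proof -
    let ?z = "iter R (J k)"
    note yD = solution_D(1)[OF y]
    note car = D_carrier[OF yD] D_carrier[OF iter_D[of "J k"]] D_carrier[OF x0_D]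
    have "real k * Phi y \<le> real k * Phi (zhat R k)"
      by (intro mult_left_mono solution_D(2)[OF y] zhat_D) simp
    then have "((vnorm (y - ?z))\<^sup>2 - (vnorm (y - x0))\<^sup>2) / (2 * lam) \<le> real k * \<delta>"
      using averaged_prox_inequality[OF yD, of k] sum_delta_k_le[of k] by linarith
    then have "(vnorm (y - ?z))\<^sup>2 \<le> (vnorm (x0 - y))\<^sup>2 + real k * rad\<^sup>2"
      using lam_pos vnorm_diff_commute[OF car(1,3)] by (simp add: rad_power2 field_simps)
    also have "\<dots> \<le> (vnorm (x0 - y) + sqrt (real k) * rad)\<^sup>2"
      using rad_nonneg by (simp add: power2_sum power_mult_distrib)
    finally have "vnorm (y - ?z) \<le> vnorm (x0 - y) + sqrt (real k) * rad"
      by (rule power2_le_imp_le) (simp add: rad_nonneg)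
    then show ?thesis
      using vnorm_diff_triangle[OF car(2,1,3)] vnorm_diff_commute[OF car(1,2)]
        vnorm_diff_commute[OF car(1,3)] by linarith
  qed
  then have "(vnorm (iter R (J k) - x0) - sqrt (real k) * rad) / 2 \<le> d0"
    unfolding dist_opt_def by (intro cINF_greatest[OF solutions_nonempty]) (simp add: field_simps)
  then show ?thesis by (simp add: field_simps)
qed

text \<open>
  The best point comes from some serious step \<open>i \<le> k\<close>, where quadratic growth keeps it within
  \<open>rad\<close> of the serious iterate because the gap there is at most \<open>\<delta>\<close>.
\<close>

lemma zhat_distance: "vnorm (zhat R k - x0) \<le> 2 * d0 + sqrt (real k) * rad + rad"
  using zhat_cases[of k]
proof
  assume "zhat R k = x0"
  then show ?thesis using d0_nonneg rad_nonneg by simp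
next
  assume "\<exists>i. 1 \<le> i \<and> i \<le> k \<and> zhat R k = best R (J i)"
  then obtain i where i: "1 \<le> i" "i \<le> k" and eq: "zhat R k = best R (J i)" by blast
  have "(vnorm (best R (J i) - iter R (J i)))\<^sup>2 / (2 * lam) \<le> \<delta>"
    using best_close_to_iter[OF J_ge_1[OF i(1)]] tau_serious[OF J_serious J_ge_1[OF i(1)]]
    by linarith
  then have "(vnorm (best R (J i) - iter R (J i)))\<^sup>2 \<le> rad\<^sup>2"
    using lam_pos by (simp add: rad_power2 field_simps)
  then have "vnorm (best R (J i) - iter R (J i)) \<le> rad"
    by (rule power2_le_imp_le[OF _ rad_nonneg])
  moreover have "sqrt (real i) * rad \<le> sqrt (real k) * rad"
    using i rad_nonneg by (intro mult_right_mono) auto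
  ultimately show ?thesis
    using serious_iterate_distance[of i]
      vnorm_diff_triangle[OF D_carrier[OF best_D] D_carrier[OF iter_D] D_carrier[OF x0_D],
        of "J i" "J i"]
    unfolding eq by linarith
qed

text \<open>
  The first two hypotheses make \<open>2 d0\<close> and \<open>rad\<close> each at most a sixth of \<open>sqrt k * rad\<close>. The
  best point found is then within \<open>4/3 * sqrt k * rad\<close> of \<open>x0\<close>, and since \<open>(4/3)\<^sup>2 \<le> 2\<close> the
  distance term of \<^term>\<open>epshat\<close> is at most \<open>2 \<delta>\<close>; a cruder split of the distance would
  not leave a total below \<open>3 \<delta>\<close>. Similarly \<open>|z_k - x0| \<le> 7/6 * sqrt k * rad\<close>, and the third
  hypothesis bounds the norm of \<^term>\<open>vhat\<close> because \<open>(7/6)\<^sup>2 \<le> 2\<close>.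
\<close>

lemma solution_triple_reached:
  assumes k: "36 \<le> k" and kd: "144 * d0\<^sup>2 \<le> real k * rad\<^sup>2"
    and kr: "2 * rad\<^sup>2 \<le> real k * (lam * \<rho>)\<^sup>2" and \<rho>: "0 < \<rho>"
  shows "solves_at n f f' h lam \<rho> (3 * \<delta>) R J k"
proof -
  define q where "q = sqrt (real k)"
  have q2: "q\<^sup>2 = real k" by (simp add: q_def)
  have q6: "6 \<le> q" using k real_sqrt_le_mono[of 36 "real k"] by (simp add: q_def)
  have "(12 * d0)\<^sup>2 \<le> (q * rad)\<^sup>2" using kd by (simp add: power_mult_distrib q2)
  then have d: "12 * d0 \<le> q * rad"
    by (rule power2_le_imp_le) (use q6 rad_nonneg in simp)
  have r: "6 * rad \<le> q * rad" using q6 rad_nonneg by (rule mult_right_mono)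
  let ?z = "zhat R k"
  have eps: "epshat f f' h lam R J k \<le> 3 * \<delta>"
  proof -
    have "vnorm (?z - x0) \<le> 4 / 3 * (q * rad)"
      using zhat_distance[of k] d r unfolding q_def by linarith
    then have "(vnorm (?z - x0))\<^sup>2 \<le> (4 / 3 * (q * rad))\<^sup>2"
      by (intro power_mono) auto
    also have "\<dots> = 16 / 9 * (real k * (2 * lam * \<delta>))"
      by (simp add: power_mult_distrib power2_eq_square[of "4 / 3 :: real"] q2 rad_power2
          power_divide)
    also have "\<dots> \<le> 2 * (real k * (2 * lam * \<delta>))"
      using lam_pos \<delta>_pos by (intro mult_right_mono) auto
    also have "\<dots> = 2 * \<delta> * (2 * lam * real k)" by simp
    also have "\<dots> \<le> 2 * \<delta> * (2 * lam * real k) + (vnorm (?z - iter R (J k)))\<^sup>2" by simp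
    finally have dist: "(vnorm (?z - x0))\<^sup>2 - (vnorm (?z - iter R (J k)))\<^sup>2
        \<le> 2 * \<delta> * (2 * lam * real k)"
      by linarith
    have kpos: "0 < 2 * lam * real k" using lam_pos k by simp
    have "((vnorm (?z - x0))\<^sup>2 - (vnorm (?z - iter R (J k)))\<^sup>2) / (2 * lam * real k) \<le> 2 * \<delta>"
      using dist kpos by (simp only: pos_divide_le_eq)
    moreover have "(1 / real k) * (\<Sum>i = 1..k. dlt i) \<le> \<delta>"
      using sum_delta_k_le[of k] k by (simp add: field_simps)
    ultimately show ?thesis by (simp add: epshat_def J_0 run_start)
  qed
  have nrm: "vnorm (vhat lam R J k) \<le> \<rho>"
  proof -
    have "vnorm (iter R (J k) - x0) \<le> 7 / 6 * (q * rad)"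
      using serious_iterate_distance[of k] d unfolding q_def by linarith
    moreover have "7 / 6 * rad \<le> q * (lam * \<rho>)"
    proof (rule power2_le_imp_le)
      have "(7 / 6 * rad)\<^sup>2 \<le> 2 * rad\<^sup>2" by (simp add: power_mult_distrib power_divide)
      also have "\<dots> \<le> (q * (lam * \<rho>))\<^sup>2" using kr by (simp add: power_mult_distrib q2)
      finally show "(7 / 6 * rad)\<^sup>2 \<le> (q * (lam * \<rho>))\<^sup>2" .
      show "0 \<le> q * (lam * \<rho>)" using q6 lam_pos \<rho> by simp
    qed
    then have "q * (7 / 6 * rad) \<le> q * (q * (lam * \<rho>))"
      using q6 by (intro mult_left_mono) auto
    then have "7 / 6 * (q * rad) \<le> q\<^sup>2 * (lam * \<rho>)" by (simp add: power2_eq_square)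
    ultimately have "vnorm (x0 - iter R (J k)) \<le> real k * (lam * \<rho>)"
      using vnorm_diff_commute[OF D_carrier[OF x0_D] D_carrier[OF iter_D]] by (simp add: q2)
    then show ?thesis
      using k lam_pos by (simp add: vhat_def vnorm_smult J_0 run_start field_simps)
  qed
  show ?thesis
    using eps nrm vhat_eps_subgradient[of k] k D_carrier[OF zhat_D]
    by (simp add: solves_at_def solution_triple_def)
qed

end

section \<open>The iteration complexity\<close>

text \<open>
  With \<open>\<delta> = \<epsilon> / 3\<close> and \<open>m\<close> the maximum in the bound on serious steps, the three conditions of
  \<open>solution_triple_reached\<close> read \<open>36 \<le> K\<close>, \<open>216 d_0\<^sup>2 / (lam \<epsilon>) \<le> K\<close> and
  \<open>4/3 \<epsilon> / (lam \<rho>\<^sup>2) \<le> K\<close>. All hold for the least integer \<open>K \<ge> 216 m + 36\<close>. A cycle has at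
  most \<open>48 L\<close> null steps, with \<open>L = lam M M_f / \<epsilon>\<close>, and \<open>10368 = 216 * 48\<close> dominates every
  coefficient of \<open>(216 m + 37) (1 + 48 L)\<close>.
\<close>

theorem theorem6p4:
  shows "\<exists>c\<^sub>a c\<^sub>b :: real.
    \<forall>(n::nat) f f' h (M\<^sub>f::real) (M\<^sub>h::real) x\<^sub>0 (lam::real) (\<rho>::real) (\<epsilon>::real) R.
      basic_assumptions n f f' h M\<^sub>f M\<^sub>h \<and> 0 \<le> M\<^sub>f \<and> 0 \<le> M\<^sub>h \<and>
      x\<^sub>0 \<in> edom n h \<and> 0 < lam \<and> 0 < \<rho> \<and> 0 < \<epsilon> \<and>
      rpb_run n f f' h x\<^sub>0 lam (\<epsilon> / 3) R
      \<longrightarrow>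
      (let M = M\<^sub>f + M\<^sub>h;
           d\<^sub>0 = dist_opt n f h x\<^sub>0;
           S = serious_indices f f' h lam (\<epsilon> / 3) R;
           J = enumerate S
       in \<exists>k\<ge>1.
            serious_occurs S k \<and>
            solves_at n f f' h lam \<rho> \<epsilon> R J k \<and>
            (\<forall>i. 1 \<le> i \<and> i < k \<longrightarrow> \<not> solves_at n f f' h lam \<rho> \<epsilon> R J i) \<and>
            real k \<le> c\<^sub>a * (max (\<epsilon> / (lam * \<rho>\<^sup>2)) (d\<^sub>0\<^sup>2 / (lam * \<epsilon>)) + 1) \<and>
            real (J k) \<le> c\<^sub>b *
              ((max (M * M\<^sub>f / \<rho>\<^sup>2) (M * M\<^sub>f * d\<^sub>0\<^sup>2 / \<epsilon>\<^sup>2)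
                + max (\<epsilon> / (lam * \<rho>\<^sup>2)) (d\<^sub>0\<^sup>2 / (lam * \<epsilon>))
                + lam * M * M\<^sub>f / \<epsilon>) + 1))"
proof -
  have main: "\<exists>k\<ge>1.
      serious_occurs (serious_indices f f' h lam (\<epsilon> / 3) R) k \<and>
      solves_at n f f' h lam \<rho> \<epsilon> R (enumerate (serious_indices f f' h lam (\<epsilon> / 3) R)) k \<and>
      (\<forall>i. 1 \<le> i \<and> i < k \<longrightarrow>
        \<not> solves_at n f f' h lam \<rho> \<epsilon> R (enumerate (serious_indices f f' h lam (\<epsilon> / 3) R)) i) \<and>
      real k \<le> 216 * (max (\<epsilon> / (lam * \<rho>\<^sup>2)) ((dist_opt n f h x\<^sub>0)\<^sup>2 / (lam * \<epsilon>)) + 1) \<and>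
      real (enumerate (serious_indices f f' h lam (\<epsilon> / 3) R) k) \<le> 10368 *
        ((max ((M\<^sub>f + M\<^sub>h) * M\<^sub>f / \<rho>\<^sup>2) ((M\<^sub>f + M\<^sub>h) * M\<^sub>f * (dist_opt n f h x\<^sub>0)\<^sup>2 / \<epsilon>\<^sup>2)
          + max (\<epsilon> / (lam * \<rho>\<^sup>2)) ((dist_opt n f h x\<^sub>0)\<^sup>2 / (lam * \<epsilon>))
          + lam * (M\<^sub>f + M\<^sub>h) * M\<^sub>f / \<epsilon>) + 1)"
    if hyp: "basic_assumptions n f f' h M\<^sub>f M\<^sub>h" "0 \<le> M\<^sub>f" "0 \<le> M\<^sub>h" "x\<^sub>0 \<in> edom n h" "0 < lam"
      "0 < \<rho>" "0 < \<epsilon>" "rpb_run n f f' h x\<^sub>0 lam (\<epsilon> / 3) R"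
    for n f f' h M\<^sub>f M\<^sub>h x\<^sub>0 lam \<rho> \<epsilon> R
  proof -
    interpret rpb_execution n f f' h M\<^sub>f M\<^sub>h x\<^sub>0 lam "\<epsilon> / 3" R
      using hyp by unfold_locales auto
    define m where "m = max (\<epsilon> / (lam * \<rho>\<^sup>2)) (d0\<^sup>2 / (lam * \<epsilon>))"
    define L where "L = lam * (M\<^sub>f + M\<^sub>h) * M\<^sub>f / \<epsilon>"
    define K where "K = nat \<lceil>216 * m + 36\<rceil>"
    have m: "0 \<le> m" "\<epsilon> / (lam * \<rho>\<^sup>2) \<le> m" "d0\<^sup>2 / (lam * \<epsilon>) \<le> m"
      using hyp by (auto simp: m_def le_max_iff_disj)
    have L: "0 \<le> L" using hyp by (simp add: L_def)
    have K_lower: "216 * m + 36 \<le> real K"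
      using m(1) by (simp add: K_def)
    have K_upper: "real K \<le> 216 * m + 37"
      using m(1) of_int_ceiling_le_add_one[of "216 * m + 36"] by (simp add: K_def)
    have K_d: "144 * d0\<^sup>2 \<le> real K * rad\<^sup>2"
    proof -
      have "216 * (d0\<^sup>2 / (lam * \<epsilon>)) \<le> real K" using K_lower m by linarith
      then show ?thesis using hyp by (simp add: rad_power2 field_simps)
    qed
    have K_r: "2 * rad\<^sup>2 \<le> real K * (lam * \<rho>)\<^sup>2"
    proof -
      have "4 / 3 * (\<epsilon> / (lam * \<rho>\<^sup>2)) \<le> real K" using K_lower m by linarith
      then have "4 / 3 * \<epsilon> \<le> real K * (lam * \<rho>\<^sup>2)" using hyp by (simp add: field_simps)
      then have "lam * (4 / 3 * \<epsilon>) \<le> lam * (real K * (lam * \<rho>\<^sup>2))"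
        using hyp by (intro mult_left_mono) auto
      then show ?thesis unfolding rad_power2 by (simp add: power2_eq_square mult_ac)
    qed
    have "36 \<le> K" using K_lower m(1) by linarith
    then have solved: "solves_at n f f' h lam \<rho> \<epsilon> R J K"
      using solution_triple_reached[OF _ K_d K_r hyp(6)] by simp
    define k where "k = (LEAST k. 1 \<le> k \<and> solves_at n f f' h lam \<rho> \<epsilon> R J k)"
    have k: "1 \<le> k \<and> solves_at n f f' h lam \<rho> \<epsilon> R J k"
      unfolding k_def by (rule LeastI[of _ K]) (use solved \<open>36 \<le> K\<close> in auto)
    have k_least: "\<not> solves_at n f f' h lam \<rho> \<epsilon> R J i" if "1 \<le> i \<and> i < k" for i
      using not_less_Least[of i] that unfolding k_def by blast
    have "k \<le> K" unfolding k_def by (rule Least_le) (use solved \<open>36 \<le> K\<close> in auto)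
    then have k_upper: "real k \<le> 216 * m + 37" using K_upper by linarith
    have nb: "null_bound = 48 * L" by (simp add: null_bound_def L_def)
    have mL: "m * L = max ((M\<^sub>f + M\<^sub>h) * M\<^sub>f / \<rho>\<^sup>2) ((M\<^sub>f + M\<^sub>h) * M\<^sub>f * d0\<^sup>2 / \<epsilon>\<^sup>2)"
    proof -
      have "m * L = max (\<epsilon> / (lam * \<rho>\<^sup>2) * L) (d0\<^sup>2 / (lam * \<epsilon>) * L)"
        using L by (simp add: m_def max_mult_distrib_right)
      also have "\<epsilon> / (lam * \<rho>\<^sup>2) * L = (M\<^sub>f + M\<^sub>h) * M\<^sub>f / \<rho>\<^sup>2"
        using hyp by (simp add: L_def)
      also have "d0\<^sup>2 / (lam * \<epsilon>) * L = (M\<^sub>f + M\<^sub>h) * M\<^sub>f * d0\<^sup>2 / \<epsilon>\<^sup>2"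
        using hyp by (simp add: L_def power2_eq_square)
      finally show ?thesis .
    qed
    have "real (J k) \<le> real k * (1 + null_bound)" by (rule J_bound)
    also have "\<dots> \<le> (216 * m + 37) * (1 + 48 * L)"
      using k_upper L unfolding nb by (intro mult_right_mono) auto
    also have "\<dots> \<le> 10368 * (m * L + m + L + 1)"
      using m(1) L by (simp add: algebra_simps)
    finally have total: "real (J k) \<le> 10368 * (m * L + m + L + 1)" .
    have "serious_occurs S k" using infinite_serious by (simp add: serious_occurs_def)
    moreover have "real k \<le> 216 * (m + 1)" using k_upper by simp
    ultimately show ?thesis
      using k k_least total unfolding mL unfolding m_def L_def J_def by blast
  qed
  show ?thesis
    unfolding Let_def
    by (intro exI[of _ "216 :: real"] exI[of _ "10368 :: real"] allI impI) (elim conjE, rule main)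
qed

end
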